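(* Let $\mathcal F\subseteq\{\pm1\}^{\mathcal X}$ be a nonempty class with finite Littlestone dimension and let $\lambda>0$. In the online binary prediction problem with loss $|\hat y-y|$, the relaxation $$\mathbf{Rel}_T(\mathcal F\mid(x^t,y^t))=\frac1\lambda\log\Big(\sum_{\sigma\in\mathcal F|_{x^t}}g(\mathrm{Ldim}(\mathcal F_t(\sigma)),T-t)\exp\{-\lambda L_t(\sigma)\}\Big)+2\lambda(T-t)$$ is admissible and leads to the admissible algorithm $$q_t(+1)=\frac{\sum_{(\sigma,+1)\in\mathcal F|_{x^t}}g(\mathrm{Ldim}(\mathcal F_t(\sigma,+1)),T-t)\exp\{-\lambda L_{t-1}(\sigma)\}}{\sum_{(\sigma,\sigma_t)\in\mathcal F|_{x^t}}g(\mathrm{Ldim}(\mathcal F_t(\sigma,\sigma_t)),T-t)\exp\{-\lambda L_{t-1}(\sigma)\}},\qquad q_t(-1)=1-q_t(+1).$$ An alternative method, admissible for the same relaxation and with the same regret guarantee (expected regret at most $\mathbf{Rel}_T(\mathcal F)$), is to predict the label according to the distribution on $\{\pm1\}$ with mean $$q_t=\frac1{2\lambda}\log\frac{\sum_{(\sigma,\sigma_t)\in\mathcal F|_{x^t}}g(\mathrm{Ldim}(\mathcal F_t(\sigma,\sigma_t)),T-t)\exp\{-\lambda L_{t-1}(\sigma)\}\exp\{-\lambda(1-\sigma_t)\}}{\sum_{(\sigma,\sigma_t)\in\mathcal F|_{x^t}}g(\mathrm{Ldim}(\mathcal F_t(\sigma,\sigma_t)),T-t)\exp\{-\lambda L_{t-1}(\sigma)\}\exp\{-\lambda(1+\sigma_t)\}}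 .$$
   Context: Protocol: on each round $t=1,\dots,T$ Nature presents $x_t\in\mathcal X$, the learner chooses a distribution $q_t$ on $\{\pm1\}$ and draws $\hat y_t\sim q_t$, Nature simultaneously chooses $y_t\in\{\pm1\}$; the learner suffers $|\hat y_t-y_t|$. Regret is $\sum_t|\hat y_t-y_t|-\inf_{f\in\mathcal F}\sum_t|f(x_t)-y_t|$. Notation: $x^t=(x_1,\dots,x_t)$, $y^t=(y_1,\dots,y_t)$; $\mathcal F|_{x^t}=\{(f(x_1),\dots,f(x_t)):f\in\mathcal F\}\subseteq\{\pm1\}^t$; for $\sigma\in\{\pm1\}^t$, $\mathcal F_t(\sigma)=\{f\in\mathcal F:f(x_i)=\sigma_i\ \forall i\le t\}$ and $L_t(\sigma)=\sum_{i=1}^t|\sigma_i-y_i|$. In the formulas for $q_t$, $\sigma\in\{\pm1\}^{t-1}$ and $\sigma_t\in\{\pm1\}$, so $(\sigma,\sigma_t)\in\{\pm1\}^t$. $g(d,n)=\sum_{i=0}^d\binom ni$. $\mathrm{Ldim}(\mathcal G)$ is the Littlestone dimension: the largest $d$ such that there is an $\mathcal X$-valued tree of depth $d$ (maps $\mathbf x_i:\{\pm1\}^{i-1}\to\mathcal X$, $i\le d$) such that for every $\epsilon\in\{\pm1\}^d$ some $f\in\mathcal G$ satisfies $f(\mathbf x_i(\epsilon_{1:i-1}))=\epsilon_i$ for all $i\le d$. $\mathbf{Rel}_T(\mathcal F)$ denotes the relaxation at $t=0$. Admissibility of a relaxation: for all $(x_1,y_1),\dots,(x_T,y_T)\in\mathcal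 X\times\{\pm1\}$ and $1\le t\le T$, $\sup_{x_t}\inf_{q}\max_{y_t\in\{\pm1\}}\{\mathbb E_{\hat y\sim q}|\hat y-y_t|+\mathbf{Rel}_T(\mathcal F\mid(x^t,y^t))\}\le\mathbf{Rel}_T(\mathcal F\mid(x^{t-1},y^{t-1}))$, where $q$ ranges over distributions on $\{\pm1\}$, and $\mathbf{Rel}_T(\mathcal F\mid(x^T,y^T))\ge-\inf_{f\in\mathcal F}\sum_{t=1}^T|f(x_t)-y_t|$. An algorithm $q_t=q_t(x^t,y^{t-1})$ is admissible for the relaxation if for every $x_t$, $\max_{y_t\in\{\pm1\}}\{\mathbb E_{\hat y\sim q_t}|\hat y-y_t|+\mathbf{Rel}_T(\mathcal F\mid(x^t,y^t))\}\le\mathbf{Rel}_T(\mathcal F\mid(x^{t-1},y^{t-1}))$. *)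

theory Defs
  imports "HOL-Probability.Probability"
begin

text \<open>
  Labels are the reals \<open>1\<close> and \<open>-1\<close>, so that the loss is literally \<open>\<bar>yhat - y\<bar>\<close>.
  The sequences \<open>x\<^sup>t\<close>, \<open>y\<^sup>t\<close> and the sign patterns \<open>\<sigma>\<close> are lists of length \<open>t\<close>;
  \<open>(\<sigma>, s)\<close> is \<open>\<sigma> @ [s]\<close>.
\<close>

definition labels :: "real set" where
  "labels = {-1, 1}"

definition label_dists :: "real pmf set" where
  "label_dists = {q. set_pmf q \<subseteq> labels}"

definition expected_loss :: "real pmf \<Rightarrow> real \<Rightarrow> real" where
  "expected_loss q y = measure_pmf.expectation q (\<lambda>yhat. \<bar>yhat - y\<bar>)"


subsection \<open>Littlestone dimension\<close>

text \<open>
  A tree of depth \<open>d\<close> is given by one map \<open>tree\<close> on sign lists; its \<open>i\<close>-th level is the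
  restriction of \<open>tree\<close> to lists of length \<open>i\<close>, counting levels from \<open>0\<close>.
\<close>

definition shattered_depth :: "('x \<Rightarrow> real) set \<Rightarrow> nat \<Rightarrow> bool" where
  "shattered_depth G d \<longleftrightarrow>
     (\<exists>tree :: real list \<Rightarrow> 'x.
        \<forall>\<epsilon>. length \<epsilon> = d \<and> set \<epsilon> \<subseteq> labels \<longrightarrow>
          (\<exists>f\<in>G. \<forall>i<d. f (tree (take i \<epsilon>)) = \<epsilon> ! i))"

text \<open>
  For nonempty \<open>G\<close> depth \<open>0\<close> is always shattered, so a finite supremum is attained.
  The value for the empty class, here \<open>0\<close>, is never used below.
\<close>

definition Ldim :: "('x \<Rightarrow> real) set \<Rightarrow> enat" where
  "Ldim G = Sup (enat ` {d. shattered_depth G d})"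


subsection \<open>The relaxation\<close>

definition restr :: "('x \<Rightarrow> real) set \<Rightarrow> 'x list \<Rightarrow> real list set" where
  "restr F xs = (\<lambda>f. map f xs) ` F"

definition version_space :: "('x \<Rightarrow> real) set \<Rightarrow> 'x list \<Rightarrow> real list \<Rightarrow> ('x \<Rightarrow> real) set" where
  "version_space F xs \<sigma> = {f \<in> F. map f xs = \<sigma>}"

definition cumloss :: "real list \<Rightarrow> real list \<Rightarrow> real" where
  "cumloss \<sigma> ys = (\<Sum>i<length \<sigma>. \<bar>\<sigma> ! i - ys ! i\<bar>)"

definition binom_sum :: "nat \<Rightarrow> nat \<Rightarrow> nat" where
  "binom_sum d n = (\<Sum>i=0..d. n choose i)"

definition weight :: "('x \<Rightarrow> real) set \<Rightarrow> nat \<Rightarrow> 'x list \<Rightarrow> real list \<Rightarrow> real" where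
  "weight F T xs \<sigma> = real (binom_sum (the_enat (Ldim (version_space F xs \<sigma>))) (T - length xs))"

definition Rel :: "real \<Rightarrow> nat \<Rightarrow> ('x \<Rightarrow> real) set \<Rightarrow> 'x list \<Rightarrow> real list \<Rightarrow> real" where
  "Rel lam T F xs ys =
     1 / lam * ln (\<Sum>\<sigma>\<in>restr F xs. weight F T xs \<sigma> * exp (- lam * cumloss \<sigma> ys))
       + 2 * lam * real (T - length xs)"


subsection \<open>Admissibility\<close>

text \<open>
  The supremum over instances and the infimum over distributions are taken in \<open>ereal\<close>,
  where they exist without boundedness conditions.
\<close>

definition admissible_relaxation ::
  "nat \<Rightarrow> ('x \<Rightarrow> real) set \<Rightarrow> ('x list \<Rightarrow> real list \<Rightarrow> real) \<Rightarrow> bool" where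
  "admissible_relaxation T F R \<longleftrightarrow>
     (\<forall>xs ys. length xs = T \<and> length ys = T \<and> set ys \<subseteq> labels \<longrightarrow>
        (\<forall>t\<in>{1..T}.
           (SUP x. INF q\<in>label_dists.
              ereal (MAX y\<in>labels.
                expected_loss q y + R (take (t - 1) xs @ [x]) (take (t - 1) ys @ [y])))
           \<le> ereal (R (take (t - 1) xs) (take (t - 1) ys)))
        \<and> R xs ys \<ge> - (INF f\<in>F. \<Sum>i<T. \<bar>f (xs ! i) - ys ! i\<bar>))"

text \<open>The first argument of an algorithm is \<open>x\<^sup>t\<close>, the second the labels of the first \<open>t - 1\<close> rounds.\<close>

type_synonym 'x algorithm = "'x list \<Rightarrow> real list \<Rightarrow> real pmf"

definition admissible_algorithm ::
  "nat \<Rightarrow> ('x list \<Rightarrow> real list \<Rightarrow> real) \<Rightarrow> 'x algorithm \<Rightarrow> bool" where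
  "admissible_algorithm T R alg \<longleftrightarrow>
     (\<forall>t\<in>{1..T}. \<forall>xs ys x.
        length xs = t - 1 \<and> length ys = t - 1 \<and> set ys \<subseteq> labels \<longrightarrow>
          alg (xs @ [x]) ys \<in> label_dists \<and>
          (MAX y\<in>labels. expected_loss (alg (xs @ [x]) ys) y + R (xs @ [x]) (ys @ [y]))
            \<le> R xs ys)"


subsection \<open>The protocol and its regret\<close>

text \<open>
  A transcript lists the triples \<open>(x, yhat, y)\<close> of the rounds played so far. Nature is adaptive
  and may randomise: \<open>nx\<close> chooses the next instance from the transcript, and \<open>ny\<close> chooses the
  label from the transcript and that instance, but without seeing the current prediction
  \<open>yhat\<close>, since the two are chosen simultaneously.
\<close>

type_synonym 'x transcript = "('x \<times> real \<times> real) list"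

primrec play ::
  "'x algorithm \<Rightarrow> ('x transcript \<Rightarrow> 'x pmf) \<Rightarrow> ('x transcript \<Rightarrow> 'x \<Rightarrow> real pmf) \<Rightarrow>
     nat \<Rightarrow> 'x transcript pmf" where
  "play alg nx ny 0 = return_pmf []"
| "play alg nx ny (Suc n) =
     bind_pmf (play alg nx ny n) (\<lambda>h.
     bind_pmf (nx h) (\<lambda>x.
     bind_pmf (alg (map (\<lambda>(x, yhat, y). x) h @ [x]) (map (\<lambda>(x, yhat, y). y) h)) (\<lambda>yhat.
     bind_pmf (ny h x) (\<lambda>y.
     return_pmf (h @ [(x, yhat, y)])))))"

definition regret :: "('x \<Rightarrow> real) set \<Rightarrow> 'x transcript \<Rightarrow> real" where
  "regret F h = (\<Sum>(x, yhat, y)\<leftarrow>h. \<bar>yhat - y\<bar>) - (INF f\<in>F. \<Sum>(x, yhat, y)\<leftarrow>h. \<bar>f x - y\<bar>)"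

definition regret_bounded_by ::
  "nat \<Rightarrow> ('x \<Rightarrow> real) set \<Rightarrow> 'x algorithm \<Rightarrow> real \<Rightarrow> bool" where
  "regret_bounded_by T F alg B \<longleftrightarrow>
     (\<forall>nx ny. (\<forall>h x. ny h x \<in> label_dists) \<longrightarrow>
        measure_pmf.expectation (play alg nx ny T) (regret F) \<le> B)"


subsection \<open>The two algorithms\<close>

text \<open>In this section \<open>xs\<close> stands for \<open>x\<^sup>t\<close> and \<open>ys\<close> for the labels of the first \<open>t - 1\<close> rounds.\<close>

definition prob_plus :: "real \<Rightarrow> nat \<Rightarrow> ('x \<Rightarrow> real) set \<Rightarrow> 'x list \<Rightarrow> real list \<Rightarrow> real" where
  "prob_plus lam T F xs ys =
     (\<Sum>\<sigma>\<in>{\<sigma>. \<sigma> @ [1] \<in> restr F xs}. weight F T xs (\<sigma> @ [1]) * exp (- lam * cumloss \<sigma> ys)) /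
     (\<Sum>(\<sigma>, s)\<in>{(\<sigma>, s). \<sigma> @ [s] \<in> restr F xs}.
        weight F T xs (\<sigma> @ [s]) * exp (- lam * cumloss \<sigma> ys))"

definition mean_pred :: "real \<Rightarrow> nat \<Rightarrow> ('x \<Rightarrow> real) set \<Rightarrow> 'x list \<Rightarrow> real list \<Rightarrow> real" where
  "mean_pred lam T F xs ys =
     1 / (2 * lam) * ln (
       (\<Sum>(\<sigma>, s)\<in>{(\<sigma>, s). \<sigma> @ [s] \<in> restr F xs}.
          weight F T xs (\<sigma> @ [s]) * exp (- lam * cumloss \<sigma> ys) * exp (- lam * (1 - s))) /
       (\<Sum>(\<sigma>, s)\<in>{(\<sigma>, s). \<sigma> @ [s] \<in> restr F xs}.
          weight F T xs (\<sigma> @ [s]) * exp (- lam * cumloss \<sigma> ys) * exp (- lam * (1 + s))))"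

text \<open>
  \<open>bernoulli_pmf\<close> truncates its parameter to the unit interval, so \<open>label_pmf p\<close> gives
  \<open>1\<close> probability \<open>p\<close> only for \<open>0 \<le> p \<le> 1\<close>. That the two algorithms below really have
  the prescribed probabilities and the prescribed mean is therefore a separate claim,
  expressed by the two predicates that follow them.
\<close>

definition label_pmf :: "real \<Rightarrow> real pmf" where
  "label_pmf p = map_pmf (\<lambda>b. if b then 1 else -1) (bernoulli_pmf p)"

definition weighted_alg :: "real \<Rightarrow> nat \<Rightarrow> ('x \<Rightarrow> real) set \<Rightarrow> 'x algorithm" where
  "weighted_alg lam T F xs ys = label_pmf (prob_plus lam T F xs ys)"

definition mean_alg :: "real \<Rightarrow> nat \<Rightarrow> ('x \<Rightarrow> real) set \<Rightarrow> 'x algorithm" where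
  "mean_alg lam T F xs ys = label_pmf ((1 + mean_pred lam T F xs ys) / 2)"

definition predicts_plus_with_prob ::
  "nat \<Rightarrow> 'x algorithm \<Rightarrow> ('x list \<Rightarrow> real list \<Rightarrow> real) \<Rightarrow> bool" where
  "predicts_plus_with_prob T alg p \<longleftrightarrow>
     (\<forall>t\<in>{1..T}. \<forall>xs ys. length xs = t \<and> length ys = t - 1 \<and> set ys \<subseteq> labels \<longrightarrow>
        alg xs ys \<in> label_dists \<and>
        pmf (alg xs ys) 1 = p xs ys \<and> pmf (alg xs ys) (-1) = 1 - p xs ys)"

definition predicts_with_mean ::
  "nat \<Rightarrow> 'x algorithm \<Rightarrow> ('x list \<Rightarrow> real list \<Rightarrow> real) \<Rightarrow> bool" where
  "predicts_with_mean T alg m \<longleftrightarrow>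
     (\<forall>t\<in>{1..T}. \<forall>xs ys. length xs = t \<and> length ys = t - 1 \<and> set ys \<subseteq> labels \<longrightarrow>
        alg xs ys \<in> label_dists \<and>
        measure_pmf.expectation (alg xs ys) (\<lambda>yhat. yhat) = m xs ys)"

end

theory Submission
  imports Defs
begin

text \<open>
  Let \<open>A\<^sub>s\<close> be the weighted mass of the patterns whose last label is \<open>s\<close>, without the loss of the
  current round. If both halves of a version space of dimension \<open>d\<close> are nonempty, one of them has
  dimension at most \<open>d - 1\<close>, so Pascal's rule for \<open>g\<close> bounds \<open>A\<^sub>1 + A\<^sub>-\<^sub>1\<close> by the sum in the
  relaxation one round earlier. Predicting \<open>s\<close> with probability proportional to \<open>A\<^sub>s\<close>, the estimate
  \<open>exp (- u) \<le> 1 - u + u\<^sup>2 / 2\<close> at \<open>u = 2 \<lambda>\<close> gives the admissibility inequality. The second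
  algorithm is the equaliser of the two possible labels; since the expected losses at the two labels
  add up to \<open>2\<close> whatever the prediction, its common value is the average of the two values of the
  first algorithm. Finally, loss plus relaxation is a supermartingale along the play.
\<close>

subsection \<open>Littlestone dimension of the two halves of a class\<close>

lemma shattered_depth_mono:
  assumes "shattered_depth G d" and "G \<subseteq> H"
  shows "shattered_depth H d"
  using assms unfolding shattered_depth_def by (meson subsetD)

text \<open>Any padding of a short sign sequence to length \<open>d\<close> will do: the first
  \<open>k\<close> levels of the same tree read only prefixes of the unpadded part.\<close>

lemma shattered_depth_le:
  assumes "shattered_depth G d" and "k \<le> d"
  shows "shattered_depth G k"
proof -
  obtain tree where tree: "\<And>\<epsilon>. length \<epsilon> = d \<Longrightarrow> set \<epsilon> \<subseteq> labels \<Longrightarrow>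
      \<exists>f\<in>G. \<forall>i<d. f (tree (take i \<epsilon>)) = \<epsilon> ! i"
    using assms(1) unfolding shattered_depth_def by blast
  have "\<exists>f\<in>G. \<forall>i<k. f (tree (take i \<epsilon>)) = \<epsilon> ! i"
    if \<epsilon>: "length \<epsilon> = k" "set \<epsilon> \<subseteq> labels" for \<epsilon>
  proof -
    let ?\<epsilon> = "\<epsilon> @ replicate (d - k) 1"
    have "length ?\<epsilon> = d" "set ?\<epsilon> \<subseteq> labels"
      using \<epsilon> assms(2) by (auto simp: labels_def)
    from tree[OF this] obtain f where f: "f \<in> G" "\<And>i. i < d \<Longrightarrow> f (tree (take i ?\<epsilon>)) = ?\<epsilon> ! i"
      by blast
    have "f (tree (take i \<epsilon>)) = \<epsilon> ! i" if "i < k" for i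
      using f(2)[of i] that \<epsilon>(1) assms(2) by (simp add: nth_append)
    with f(1) show ?thesis by blast
  qed
  then show ?thesis unfolding shattered_depth_def by blast
qed

text \<open>The two trees are glued under a root \<open>x\<close>: the first sign is the value
  demanded at \<open>x\<close> and selects the subtree for the remaining signs.\<close>

lemma shattered_depth_Suc:
  assumes "shattered_depth {f \<in> G. f x = 1} d" and "shattered_depth {f \<in> G. f x = -1} d"
  shows "shattered_depth G (Suc d)"
proof -
  obtain tp where tp: "\<And>\<epsilon>. length \<epsilon> = d \<Longrightarrow> set \<epsilon> \<subseteq> labels \<Longrightarrow>
      \<exists>f\<in>{f \<in> G. f x = 1}. \<forall>i<d. f (tp (take i \<epsilon>)) = \<epsilon> ! i"
    using assms(1) unfolding shattered_depth_def by blast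
  obtain tm where tm: "\<And>\<epsilon>. length \<epsilon> = d \<Longrightarrow> set \<epsilon> \<subseteq> labels \<Longrightarrow>
      \<exists>f\<in>{f \<in> G. f x = -1}. \<forall>i<d. f (tm (take i \<epsilon>)) = \<epsilon> ! i"
    using assms(2) unfolding shattered_depth_def by blast
  define tree where
    "tree = (\<lambda>\<epsilon>. case \<epsilon> of [] \<Rightarrow> x | e # es \<Rightarrow> if e = (1::real) then tp es else tm es)"
  have "\<exists>f\<in>G. \<forall>i<Suc d. f (tree (take i \<epsilon>)) = \<epsilon> ! i"
    if len: "length \<epsilon> = Suc d" and lab: "set \<epsilon> \<subseteq> labels" for \<epsilon>
  proof -
    obtain e es where \<epsilon>: "\<epsilon> = e # es" "length es = d" "set es \<subseteq> labels" "e \<in> labels"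
      using len lab by (cases \<epsilon>) auto
    obtain f where f: "f \<in> G" "f x = e"
        "\<And>i. i < d \<Longrightarrow> f ((if e = 1 then tp else tm) (take i es)) = es ! i"
      using tp[OF \<epsilon>(2,3)] tm[OF \<epsilon>(2,3)] \<epsilon>(4) by (fastforce simp: labels_def)
    have "f (tree (take i \<epsilon>)) = \<epsilon> ! i" if "i < Suc d" for i
    proof (cases i)
      case 0
      then show ?thesis by (simp add: tree_def \<epsilon>(1) f(2))
    next
      case (Suc j)
      then show ?thesis using f(3)[of j] that
        by (auto simp: tree_def \<epsilon>(1) split: if_splits)
    qed
    with f(1) show ?thesis by blast
  qed
  then show ?thesis unfolding shattered_depth_def by blast
qed

lemma Ldim_mono:
  assumes "G \<subseteq> H"
  shows "Ldim G \<le> Ldim H"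
  unfolding Ldim_def using assms by (auto intro!: Sup_subset_mono intro: shattered_depth_mono)

text \<open>In \<open>enat\<close> a nonempty set with finite supremum is finite, so the supremum is
  a maximum and is attained. Depth \<open>0\<close> makes the set nonempty.\<close>

lemma shattered_depth_Ldim:
  assumes "G \<noteq> {}" and "Ldim G < \<infinity>"
  shows "shattered_depth G (the_enat (Ldim G))"
proof -
  let ?A = "enat ` {d. shattered_depth G d}"
  have "shattered_depth G 0"
    using assms(1) by (auto simp: shattered_depth_def)
  then have ne: "?A \<noteq> {}" by blast
  have fin: "finite ?A"
    using assms(2) ne by (auto simp: Ldim_def Sup_enat_def split: if_splits)
  have "Ldim G = Max ?A"
    unfolding Ldim_def using ne fin by (simp only: Sup_enat_def if_True if_False)
  then have "Ldim G \<in> ?A"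
    using Max_in[OF fin ne] by simp
  then show ?thesis by auto
qed

lemma le_Ldim:
  assumes "shattered_depth G d" and "Ldim G < \<infinity>"
  shows "d \<le> the_enat (Ldim G)"
proof -
  have "enat d \<le> Ldim G"
    unfolding Ldim_def using assms(1) by (intro Sup_upper) auto
  then show ?thesis using assms(2) by (cases "Ldim G") auto
qed

lemma the_enat_Ldim_mono:
  assumes "G \<subseteq> H" and "Ldim H < \<infinity>"
  shows "the_enat (Ldim G) \<le> the_enat (Ldim H)"
  using Ldim_mono[OF assms(1)] assms(2) by (cases "Ldim G"; cases "Ldim H") auto

text \<open>Both halves shatter a tree whose depth is the smaller of their dimensions, and gluing
  adds one level. Hence the two halves cannot both keep the full dimension.\<close>

lemma Ldim_split:
  assumes fin: "Ldim G < \<infinity>"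
    and ne: "{f \<in> G. f x = 1} \<noteq> {}" "{f \<in> G. f x = -1} \<noteq> {}"
  shows "Suc (min (the_enat (Ldim {f \<in> G. f x = 1})) (the_enat (Ldim {f \<in> G. f x = -1})))
           \<le> the_enat (Ldim G)"
proof (intro le_Ldim fin shattered_depth_Suc)
  have lt: "Ldim {f \<in> G. P f} < \<infinity>" for P
    by (rule le_less_trans[OF Ldim_mono fin]) auto
  show "shattered_depth {f \<in> G. f x = 1}
      (min (the_enat (Ldim {f \<in> G. f x = 1})) (the_enat (Ldim {f \<in> G. f x = -1})))"
    by (rule shattered_depth_le[OF shattered_depth_Ldim[OF ne(1) lt]]) simp
  show "shattered_depth {f \<in> G. f x = -1}
      (min (the_enat (Ldim {f \<in> G. f x = 1})) (the_enat (Ldim {f \<in> G. f x = -1})))"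
    by (rule shattered_depth_le[OF shattered_depth_Ldim[OF ne(2) lt]]) simp
qed

section \<open>Partial binomial sums\<close>

lemma binom_sum_ge_1: "1 \<le> binom_sum d n"
proof -
  have "n choose 0 \<le> binom_sum d n"
    unfolding binom_sum_def by (rule member_le_sum) auto
  then show ?thesis by simp
qed

lemma binom_sum_mono: "d \<le> e \<Longrightarrow> binom_sum d n \<le> binom_sum e n"
  unfolding binom_sum_def by (intro sum_mono2) auto

text \<open>Pascal's rule, summed over the lower index.\<close>

lemma binom_sum_Suc_Suc: "binom_sum (Suc d) (Suc n) = binom_sum d n + binom_sum (Suc d) n"
proof (induction d)
  case (Suc d)
  have step: "binom_sum (Suc k) m = binom_sum k m + (m choose Suc k)" for k m
    by (simp add: binom_sum_def)
  show ?case
    using Suc by (simp add: step)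
qed (simp add: binom_sum_def)

lemma binom_sum_le_Suc: "binom_sum d n \<le> binom_sum d (Suc n)"
  by (cases d) (simp_all add: binom_sum_Suc_Suc, simp add: binom_sum_def)

text \<open>In Pascal's rule for \<open>d = Suc e\<close>, the smaller of the two indices is at most
  \<open>e\<close> and the larger at most \<open>d\<close>.\<close>

lemma binom_sum_add_le:
  assumes "a \<le> d" "b \<le> d" "Suc (min a b) \<le> d"
  shows "binom_sum a n + binom_sum b n \<le> binom_sum d (Suc n)"
proof -
  obtain e where e: "d = Suc e" "min a b \<le> e" using assms(3) by (cases d) auto
  have "binom_sum a n + binom_sum b n = binom_sum (min a b) n + binom_sum (max a b) n"
    by (simp add: min_def max_def)
  also have "\<dots> \<le> binom_sum e n + binom_sum d n"
    using assms(1,2) e by (intro add_mono binom_sum_mono) auto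
  finally show ?thesis by (simp add: e(1) binom_sum_Suc_Suc)
qed

subsection \<open>One round of the two algorithms\<close>

text \<open>The quadratic Taylor polynomial is below \<open>exp u\<close>, and its product with the
  same polynomial at \<open>- u\<close> is \<open>1 + u ^ 4 / 4\<close>, hence at least
  \<open>1\<close>.\<close>

lemma exp_minus_le_quadratic:
  fixes u :: real
  assumes "0 \<le> u"
  shows "exp (- u) \<le> 1 - u + u\<^sup>2 / 2"
proof -
  have "1 + u + u\<^sup>2 / 2 \<le> exp u" by (rule exp_lower_Taylor_quadratic[OF assms])
  then have "(1 - u + u\<^sup>2 / 2) * (1 + u + u\<^sup>2 / 2) \<le> (1 - u + u\<^sup>2 / 2) * exp u"
    \<comment> \<open>The multiplier is nonnegative because twice it equals
      \<open>(1 - u)\<^sup>2 + 1\<close>.\<close>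
    using sum_squares_ge_zero[of "1 - u" 1]
    by (intro mult_left_mono) (auto simp: power2_eq_square algebra_simps)
  moreover have "(1 - u + u\<^sup>2 / 2) * (1 + u + u\<^sup>2 / 2) = 1 + u ^ 4 / 4"
    by (simp add: algebra_simps power2_eq_square power4_eq_xxxx)
  ultimately have "1 \<le> (1 - u + u\<^sup>2 / 2) * exp u"
    using zero_le_power[OF assms, of 4] by linarith
  then show ?thesis by (simp add: exp_minus field_simps)
qed

text \<open>Here \<open>a\<close> is the mass of the label that occurs, \<open>b\<close> the mass of
  the other one, and \<open>B\<close> the total one round earlier. The first summand is the expected
  loss when predicting in proportion to mass; the final \<open>2 * lam\<close> pays for the
  quadratic error of the exponential.\<close>

lemma exp_weights_step:
  fixes a b B lam :: real
  assumes "0 \<le> a" "0 \<le> b" "0 < a + b" "a + b \<le> B" "0 < lam"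
  shows "2 * (b / (a + b)) + 1 / lam * ln (a + b * exp (- (2 * lam))) \<le> 1 / lam * ln B + 2 * lam"
proof -
  define r where "r = b / (a + b)"
  have r: "0 \<le> r" "r \<le> 1" using assms by (auto simp: r_def field_simps)
  have br: "(a + b) * r = b" using assms(3) by (simp add: r_def)
  have "(a + b) * (1 - r + r * exp (- (2 * lam)))
      = (a + b) - (a + b) * r + (a + b) * r * exp (- (2 * lam))"
    by (simp add: algebra_simps)
  then have "a + b * exp (- (2 * lam)) = (a + b) * (1 - r + r * exp (- (2 * lam)))"
    unfolding br by simp
  also have "\<dots> \<le> (a + b) * (1 + (- (2 * lam * r) + 2 * lam\<^sup>2))"
  proof (intro mult_left_mono)
    have "r * exp (- (2 * lam)) \<le> r * (1 - 2 * lam + 2 * lam\<^sup>2)"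
      using exp_minus_le_quadratic[of "2 * lam"] r assms(5)
      by (intro mult_left_mono) (auto simp: power2_eq_square)
    \<comment> \<open>Only the quadratic term is enlarged, using \<open>r \<le> 1\<close>, so that
      the error no longer depends on the masses.\<close>
    also have "\<dots> \<le> r - 2 * lam * r + 2 * lam\<^sup>2"
      using mult_right_mono[OF r(2), of "2 * lam\<^sup>2"] by (simp add: algebra_simps)
    finally show "1 - r + r * exp (- (2 * lam)) \<le> 1 + (- (2 * lam * r) + 2 * lam\<^sup>2)" by simp
  qed (use assms in auto)
  \<comment> \<open>The bound \<open>1 + z \<le> exp z\<close> gives a form in which the logarithm
    becomes linear in \<open>r\<close>.\<close>
  also have "\<dots> \<le> (a + b) * exp (- (2 * lam * r) + 2 * lam\<^sup>2)"
    using assms by (intro mult_left_mono exp_ge_add_one_self) auto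
  also have "\<dots> \<le> B * exp (- (2 * lam * r) + 2 * lam\<^sup>2)"
    using assms by (intro mult_right_mono) auto
  finally have le: "a + b * exp (- (2 * lam)) \<le> B * exp (- (2 * lam * r) + 2 * lam\<^sup>2)" .
  have "0 < a + b * exp (- (2 * lam))"
    using assms(1-3) by (cases "a = 0") (auto intro: add_pos_nonneg)
  then have "ln (a + b * exp (- (2 * lam))) \<le> ln (B * exp (- (2 * lam * r) + 2 * lam\<^sup>2))"
    using le by simp
  also have "\<dots> = ln B - 2 * lam * r + 2 * lam\<^sup>2"
    using assms by (simp add: ln_mult)
  finally have "1 / lam * ln (a + b * exp (- (2 * lam)))
      \<le> 1 / lam * (ln B - 2 * lam * r + 2 * lam\<^sup>2)"
    using assms(5) by (intro mult_left_mono) auto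
  also have "\<dots> = 1 / lam * ln B - 2 * r + 2 * lam"
    using assms(5) by (simp add: field_simps power2_eq_square)
  finally show ?thesis by (simp add: r_def)
qed

section \<open>Distributions on the two labels\<close>

lemma
  assumes "0 \<le> p" "p \<le> 1"
  shows label_pmf_label_dists: "label_pmf p \<in> label_dists"
    and pmf_label_pmf_1: "pmf (label_pmf p) 1 = p"
    and pmf_label_pmf_minus_1: "pmf (label_pmf p) (-1) = 1 - p"
    and expectation_label_pmf:
      "\<And>h :: real \<Rightarrow> real. measure_pmf.expectation (label_pmf p) h = p * h 1 + (1 - p) * h (-1)"
proof -
  have [simp]: "(\<lambda>b. if b then 1 else -1 :: real) -` {1} = {True}"
      "(\<lambda>b. if b then 1 else -1 :: real) -` {-1} = {False}"
    by (auto split: if_splits)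
  show "label_pmf p \<in> label_dists"
    by (auto simp: label_pmf_def label_dists_def labels_def)
  show "pmf (label_pmf p) 1 = p" "pmf (label_pmf p) (-1) = 1 - p"
    using assms by (simp_all add: label_pmf_def pmf_map measure_pmf_single)
  show "measure_pmf.expectation (label_pmf p) h = p * h 1 + (1 - p) * h (-1)" for h :: "real \<Rightarrow> real"
    using assms by (simp add: label_pmf_def)
qed

lemma expected_loss_label_pmf:
  assumes "0 \<le> p" "p \<le> 1"
  shows "expected_loss (label_pmf p) 1 = 2 * (1 - p)"
    and "expected_loss (label_pmf p) (-1) = 2 * p"
  using assms by (simp_all add: expected_loss_def expectation_label_pmf)

subsection \<open>Regret of an admissible algorithm\<close>

lemma integrable_bounded_pmf:
  fixes g :: "'a \<Rightarrow> real"
  assumes "\<And>y. y \<in> set_pmf p \<Longrightarrow> \<bar>g y\<bar> \<le> B"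
  shows "integrable (measure_pmf p) g"
  using assms by (intro measure_pmf.integrable_const_bound[where B = B]) (auto simp: AE_measure_pmf_iff)

lemma expectation_bind_pmf:
  fixes g :: "'b \<Rightarrow> real"
  assumes "\<And>x y. x \<in> set_pmf p \<Longrightarrow> y \<in> set_pmf (k x) \<Longrightarrow> \<bar>g y\<bar> \<le> B"
  shows "measure_pmf.expectation (bind_pmf p k) g
    = measure_pmf.expectation p (\<lambda>x. measure_pmf.expectation (k x) g)"
proof -
  \<comment> \<open>\<open>integral_bind\<close> needs a bound on the whole type, not only on the support.\<close>
  define g' where "g' y = max (- \<bar>B\<bar>) (min \<bar>B\<bar> (g y))" for y
  have eq: "g' y = g y" if "x \<in> set_pmf p" "y \<in> set_pmf (k x)" for x y
    using assms[OF that] by (auto simp: g'_def)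
  have "measure_pmf.expectation (bind_pmf p k) g = measure_pmf.expectation (bind_pmf p k) g'"
    by (intro integral_cong_AE) (auto simp: AE_measure_pmf_iff eq)
  also have "\<dots> = measure_pmf.expectation p (\<lambda>x. measure_pmf.expectation (k x) g')"
    unfolding measure_pmf_bind
    by (rule integral_bind[where K = "count_space UNIV" and B = "\<bar>B\<bar>" and B' = 1])
      (auto simp: g'_def measure_pmf.emeasure_space_1 measure_pmf.finite_measure_axioms
        measure_pmf_in_subprob_algebra)
  also have "\<dots> = measure_pmf.expectation p (\<lambda>x. measure_pmf.expectation (k x) g)"
    by (intro integral_cong_AE) (auto simp: AE_measure_pmf_iff eq intro!: integral_cong_AE)
  finally show ?thesis .
qed

lemma expectation_le_pmf:
  fixes g :: "'a \<Rightarrow> real"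
  assumes "\<And>y. y \<in> set_pmf p \<Longrightarrow> \<bar>g y\<bar> \<le> B" and "\<And>y. y \<in> set_pmf p \<Longrightarrow> g y \<le> K"
  shows "measure_pmf.expectation p g \<le> K"
  using assms(2) integrable_bounded_pmf[OF assms(1)]
  by (intro measure_pmf.integral_le_const) (auto simp: AE_measure_pmf_iff)

lemma abs_expectation_le_pmf:
  fixes g :: "'a \<Rightarrow> real"
  assumes "\<And>y. y \<in> set_pmf p \<Longrightarrow> \<bar>g y\<bar> \<le> B"
  shows "\<bar>measure_pmf.expectation p g\<bar> \<le> B"
proof -
  have "measure_pmf.expectation p g \<le> B"
    using assms by (intro expectation_le_pmf) (auto dest: abs_le_D1)
  moreover have "measure_pmf.expectation p (\<lambda>y. - g y) \<le> B"
    using assms by (intro expectation_le_pmf[where B = B]) (auto dest: abs_le_D2)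
  ultimately show ?thesis by simp
qed

text \<open>The tower rule reduces the claim to conditional expectations. Bounds are asked for only
  on the support, since the potential used below is controlled only on transcripts that can
  occur.\<close>

lemma expectation_bind_pmf_le:
  fixes g :: "'b \<Rightarrow> real"
  assumes "\<And>x y. x \<in> set_pmf p \<Longrightarrow> y \<in> set_pmf (k x) \<Longrightarrow> \<bar>g y\<bar> \<le> B"
    and "\<And>x. x \<in> set_pmf p \<Longrightarrow> measure_pmf.expectation (k x) g \<le> K"
  shows "measure_pmf.expectation (bind_pmf p k) g \<le> K"
proof -
  have "measure_pmf.expectation (bind_pmf p k) g
      = measure_pmf.expectation p (\<lambda>x. measure_pmf.expectation (k x) g)"
    by (rule expectation_bind_pmf[OF assms(1)])
  also have "\<dots> \<le> K"
    by (rule expectation_le_pmf[OF abs_expectation_le_pmf[OF assms(1)] assms(2)])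
  finally show ?thesis .
qed

section \<open>Transcripts and the supermartingale argument\<close>

abbreviation instances :: "'x transcript \<Rightarrow> 'x list" where
  "instances h \<equiv> map (\<lambda>(x, yhat, y). x) h"

abbreviation outcomes :: "'x transcript \<Rightarrow> real list" where
  "outcomes h \<equiv> map (\<lambda>(x, yhat, y). y) h"

abbreviation total_loss :: "'x transcript \<Rightarrow> real" where
  "total_loss h \<equiv> \<Sum>(x, yhat, y)\<leftarrow>h. \<bar>yhat - y\<bar>"

definition valid_transcript :: "'x transcript \<Rightarrow> bool" where
  "valid_transcript h \<longleftrightarrow> (\<forall>(x, yhat, y)\<in>set h. yhat \<in> labels \<and> y \<in> labels)"

lemma abs_diff_labels_le: "a \<in> labels \<Longrightarrow> b \<in> labels \<Longrightarrow> \<bar>a - b\<bar> \<le> 2"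
  by (auto simp: labels_def)

lemma admissible_algorithmD:
  assumes "admissible_algorithm T R alg" "length xs < T" "length ys = length xs" "set ys \<subseteq> labels"
  shows "alg (xs @ [x]) ys \<in> label_dists"
    and "y \<in> labels \<Longrightarrow> expected_loss (alg (xs @ [x]) ys) y + R (xs @ [x]) (ys @ [y]) \<le> R xs ys"
proof -
  have "Suc (length xs) \<in> {1..T}" using assms(2) by auto
  then have *: "alg (xs @ [x]) ys \<in> label_dists \<and>
      (MAX y\<in>labels. expected_loss (alg (xs @ [x]) ys) y + R (xs @ [x]) (ys @ [y])) \<le> R xs ys"
    using assms unfolding admissible_algorithm_def by fastforce
  then show "alg (xs @ [x]) ys \<in> label_dists" by blast
  show "expected_loss (alg (xs @ [x]) ys) y + R (xs @ [x]) (ys @ [y]) \<le> R xs ys" if "y \<in> labels"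
    using * that by (auto simp: labels_def)
qed

lemma admissible_algorithmI:
  assumes "\<And>xs ys x. alg (xs @ [x]) ys \<in> label_dists"
    and "\<And>xs ys x y. length xs < T \<Longrightarrow> length ys = length xs \<Longrightarrow> y \<in> labels \<Longrightarrow>
      expected_loss (alg (xs @ [x]) ys) y + R (xs @ [x]) (ys @ [y]) \<le> R xs ys"
  shows "admissible_algorithm T R alg"
  unfolding admissible_algorithm_def
proof (intro ballI allI impI conjI)
  fix t and xs :: "'a list" and ys x
  assume *: "t \<in> {1..T}" "length xs = t - 1 \<and> length ys = t - 1 \<and> set ys \<subseteq> labels"
  show "alg (xs @ [x]) ys \<in> label_dists" by (rule assms(1))
  have "length xs < T" "length ys = length xs" using * by auto
  from assms(2)[OF this]
  show "(MAX y\<in>labels. expected_loss (alg (xs @ [x]) ys) y + R (xs @ [x]) (ys @ [y])) \<le> R xs ys"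
    by (auto simp: labels_def)
qed

text \<open>Admissibility makes the potential \<open>\<Phi>\<close> a supermartingale; it starts at
  \<open>R [] []\<close> and, by \<open>final\<close>, dominates the regret after \<open>T\<close>
  rounds. The remaining work is integrability, for which \<open>low\<close> bounds the relaxation
  from below.\<close>

lemma regret_bounded_by_admissible:
  fixes F :: "('x \<Rightarrow> real) set"
  assumes adm: "admissible_algorithm T R alg"
    and F: "F \<noteq> {}" "\<forall>f\<in>F. \<forall>x. f x \<in> labels"
    and low: "\<And>xs ys. length xs \<le> T \<Longrightarrow> length ys = length xs \<Longrightarrow> set ys \<subseteq> labels \<Longrightarrow> c \<le> R xs ys"
    and final: "\<And>h. length h = T \<Longrightarrow> set (outcomes h) \<subseteq> labels \<Longrightarrow>
      - (INF f\<in>F. \<Sum>(x, yhat, y)\<leftarrow>h. \<bar>f x - y\<bar>) \<le> R (instances h) (outcomes h)"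
  shows "regret_bounded_by T F alg (R [] [])"
  unfolding regret_bounded_by_def
proof (intro allI impI)
  fix nx :: "'x transcript \<Rightarrow> 'x pmf" and ny :: "'x transcript \<Rightarrow> 'x \<Rightarrow> real pmf"
  assume "\<forall>h x. ny h x \<in> label_dists"
  then have ny: "y \<in> labels" if "y \<in> set_pmf (ny h x)" for h x y
    using that by (auto simp: label_dists_def)
  define \<Phi> where "\<Phi> h = total_loss h + R (instances h) (outcomes h)" for h
  \<comment> \<open>Losses are nonnegative, so by admissibility the relaxation never increases along
    a play and its initial value is an upper bound.\<close>
  have up: "R xs ys \<le> R [] []"
    if "length xs \<le> T" "length ys = length xs" "set ys \<subseteq> labels" for xs ys
    using that
  proof (induction xs arbitrary: ys rule: rev_induct)
    case (snoc x xs)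
    then obtain zs y where ys: "ys = zs @ [y]" by (cases ys rule: rev_cases) auto
    have "0 \<le> expected_loss (alg (xs @ [x]) zs) y"
      unfolding expected_loss_def by (rule integral_nonneg_AE) simp
    moreover have "expected_loss (alg (xs @ [x]) zs) y + R (xs @ [x]) (zs @ [y]) \<le> R xs zs"
      using snoc.prems ys by (intro admissible_algorithmD(2)[OF adm]) auto
    moreover have "R xs zs \<le> R [] []"
      using snoc.prems ys by (intro snoc.IH) auto
    ultimately show ?case by (simp add: ys)
  qed simp
  have out: "set (outcomes h) \<subseteq> labels" if "valid_transcript h" for h :: "'x transcript"
    using that by (auto simp: valid_transcript_def)
  have loss: "0 \<le> total_loss h" "total_loss h \<le> 2 * real (length h)"
    if "valid_transcript h" for h :: "'x transcript"
    using that by (induction h) (auto simp: valid_transcript_def labels_def)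
  \<comment> \<open>Each round costs at most \<open>2\<close>; the other two terms cover the upper
    and the lower bound of the relaxation.\<close>
  define K where "K = 2 * real T + \<bar>R [] []\<bar> + \<bar>c\<bar>"
  have bound: "\<bar>\<Phi> h\<bar> \<le> K" if "valid_transcript h" "length h \<le> T" for h
    using loss[OF that(1)] up[of "instances h" "outcomes h"] low[of "instances h" "outcomes h"]
      out[OF that(1)] that(2) by (simp add: \<Phi>_def K_def)
  have alg: "yhat \<in> labels" if "valid_transcript h" "length h < T"
      "yhat \<in> set_pmf (alg (instances h @ [x]) (outcomes h))" for h x yhat
    using admissible_algorithmD(1)[OF adm, of "instances h" "outcomes h" x] that out[OF that(1)]
    by (auto simp: label_dists_def)
  have snoc: "valid_transcript (h @ [(x, yhat, y)])" if "valid_transcript h" "length h < T"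
      "yhat \<in> set_pmf (alg (instances h @ [x]) (outcomes h))" "y \<in> set_pmf (ny h x)" for h x yhat y
    using that(1) alg[OF that(1-3)] ny[OF that(4)] by (auto simp: valid_transcript_def)
  have supp: "length h = n \<and> valid_transcript h" if "n \<le> T" "h \<in> set_pmf (play alg nx ny n)" for n h
    using that
  proof (induction n arbitrary: h)
    case (Suc n)
    then show ?case by (fastforce simp: intro: snoc)
  qed (simp add: valid_transcript_def)
  have step: "measure_pmf.expectation
        (bind_pmf (nx h) (\<lambda>x. bind_pmf (alg (instances h @ [x]) (outcomes h)) (\<lambda>yhat.
          bind_pmf (ny h x) (\<lambda>y. return_pmf (h @ [(x, yhat, y)]))))) \<Phi> \<le> \<Phi> h"
    if h: "valid_transcript h" "length h < T" for h
  proof (rule expectation_bind_pmf_le[where B = K])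
    fix x h'
    assume "h' \<in> set_pmf (bind_pmf (alg (instances h @ [x]) (outcomes h)) (\<lambda>yhat.
          bind_pmf (ny h x) (\<lambda>y. return_pmf (h @ [(x, yhat, y)]))))"
    then show "\<bar>\<Phi> h'\<bar> \<le> K" using snoc[OF h] h by (auto intro!: bound)
  next
    fix x
    let ?q = "alg (instances h @ [x]) (outcomes h)"
    \<comment> \<open>Given \<open>h\<close> and \<open>x\<close>, prediction and label are
      independent, so the label may be drawn first. With \<open>y\<close> fixed, the inner
      expectation over \<open>yhat\<close> is exactly \<open>expected_loss\<close>.\<close>
    have "measure_pmf.expectation (bind_pmf (ny h x) (\<lambda>y.
        bind_pmf ?q (\<lambda>yhat. return_pmf (h @ [(x, yhat, y)])))) \<Phi> \<le> \<Phi> h"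
    proof (rule expectation_bind_pmf_le[where B = K])
      fix y h'
      assume "y \<in> set_pmf (ny h x)"
        "h' \<in> set_pmf (bind_pmf ?q (\<lambda>yhat. return_pmf (h @ [(x, yhat, y)])))"
      then show "\<bar>\<Phi> h'\<bar> \<le> K" using snoc[OF h] h by (auto intro!: bound)
    next
      fix y
      assume y: "y \<in> set_pmf (ny h x)"
      have int: "integrable (measure_pmf ?q) (\<lambda>yhat. \<bar>yhat - y\<bar>)"
        using alg[OF h] ny[OF y] by (intro integrable_bounded_pmf[where B = 2]) (auto intro: abs_diff_labels_le)
      have "measure_pmf.expectation (bind_pmf ?q (\<lambda>yhat. return_pmf (h @ [(x, yhat, y)]))) \<Phi>
          = measure_pmf.expectation ?q (\<lambda>yhat. \<Phi> (h @ [(x, yhat, y)]))"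
        by (simp flip: map_pmf_def)
      also have "\<dots> = measure_pmf.expectation ?q
          (\<lambda>yhat. \<bar>yhat - y\<bar> + (total_loss h + R (instances h @ [x]) (outcomes h @ [y])))"
        by (simp add: \<Phi>_def algebra_simps)
      also have "\<dots> = expected_loss ?q y + R (instances h @ [x]) (outcomes h @ [y]) + total_loss h"
        using int by (simp add: expected_loss_def)
      also have "\<dots> \<le> \<Phi> h"
        using admissible_algorithmD(2)[OF adm, of "instances h" "outcomes h" y x]
          out[OF h(1)] h(2) ny[OF y] by (simp add: \<Phi>_def)
      finally show "measure_pmf.expectation
          (bind_pmf ?q (\<lambda>yhat. return_pmf (h @ [(x, yhat, y)]))) \<Phi> \<le> \<Phi> h" .
    qed
    then show "measure_pmf.expectation (bind_pmf ?q (\<lambda>yhat.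
          bind_pmf (ny h x) (\<lambda>y. return_pmf (h @ [(x, yhat, y)])))) \<Phi> \<le> \<Phi> h"
      by (subst bind_commute_pmf)
  qed
  have main: "measure_pmf.expectation (play alg nx ny n) \<Phi> \<le> R [] []" if "n \<le> T" for n
    using that
  proof (induction n)
    case 0
    then show ?case by (simp add: \<Phi>_def)
  next
    case (Suc n)
    define k where "k h = bind_pmf (nx h) (\<lambda>x. bind_pmf (alg (instances h @ [x]) (outcomes h)) (\<lambda>yhat.
          bind_pmf (ny h x) (\<lambda>y. return_pmf (h @ [(x, yhat, y)]))))" for h
    have play: "play alg nx ny (Suc n) = bind_pmf (play alg nx ny n) k"
      by (simp add: k_def[abs_def])
    have b: "\<bar>\<Phi> h'\<bar> \<le> K" if "h \<in> set_pmf (play alg nx ny n)" "h' \<in> set_pmf (k h)" for h h'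
    proof -
      have "h' \<in> set_pmf (play alg nx ny (Suc n))" unfolding play using that by auto
      from supp[OF Suc.prems this] show ?thesis using Suc.prems by (auto intro: bound)
    qed
    have "measure_pmf.expectation (play alg nx ny (Suc n)) \<Phi>
        = measure_pmf.expectation (play alg nx ny n) (\<lambda>h. measure_pmf.expectation (k h) \<Phi>)"
      unfolding play by (rule expectation_bind_pmf[OF b])
    also have "\<dots> \<le> measure_pmf.expectation (play alg nx ny n) \<Phi>"
    proof (rule integral_mono_AE)
      show "integrable (measure_pmf (play alg nx ny n)) (\<lambda>h. measure_pmf.expectation (k h) \<Phi>)"
        using b by (intro integrable_bounded_pmf abs_expectation_le_pmf) auto
      show "integrable (measure_pmf (play alg nx ny n)) \<Phi>"
        using supp[of n] Suc.prems by (intro integrable_bounded_pmf[where B = K] bound) auto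
      show "AE h in measure_pmf (play alg nx ny n). measure_pmf.expectation (k h) \<Phi> \<le> \<Phi> h"
        using supp[of n] Suc.prems by (auto simp: AE_measure_pmf_iff k_def intro!: step)
    qed
    also have "\<dots> \<le> R [] []" using Suc by simp
    finally show ?case .
  qed
  have reg_le: "regret F h \<le> \<Phi> h" if "h \<in> set_pmf (play alg nx ny T)" for h
    using supp[OF order_refl that] final[of h] out[of h] by (simp add: regret_def \<Phi>_def)
  \<comment> \<open>Integrability of the regret needs a bound from below as well: a single
    \<open>f\<close> shows that the infimum is at most \<open>2 * T\<close>.\<close>
  have reg_ge: "- (2 * real T) \<le> regret F h" if "h \<in> set_pmf (play alg nx ny T)" for h
  proof -
    have h: "length h = T" "valid_transcript h" using supp[OF order_refl that] by auto
    obtain f where f: "f \<in> F" using F(1) by blast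
    have "bdd_below ((\<lambda>f. \<Sum>(x, yhat, y)\<leftarrow>h. \<bar>f x - y\<bar>) ` F)"
      by (intro bdd_belowI2[where m = 0] sum_list_nonneg) auto
    then have "(INF f\<in>F. \<Sum>(x, yhat, y)\<leftarrow>h. \<bar>f x - y\<bar>) \<le> (\<Sum>(x, yhat, y)\<leftarrow>h. \<bar>f x - y\<bar>)"
      using f by (rule cINF_lower)
    also have "\<dots> \<le> (\<Sum>z\<leftarrow>h. 2)"
      using h(2) f F(2)
      by (intro sum_list_mono) (auto simp: valid_transcript_def intro!: abs_diff_labels_le)
    also have "\<dots> = 2 * real T" by (simp add: sum_list_triv h(1))
    finally show ?thesis using loss(1)[OF h(2)] by (simp add: regret_def)
  qed
  have "measure_pmf.expectation (play alg nx ny T) (regret F)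
      \<le> measure_pmf.expectation (play alg nx ny T) \<Phi>"
  proof (rule integral_mono_AE)
    have b: "\<bar>\<Phi> h\<bar> \<le> K" if "h \<in> set_pmf (play alg nx ny T)" for h
      using supp[OF order_refl that] by (auto intro: bound)
    then show "integrable (measure_pmf (play alg nx ny T)) \<Phi>"
      by (rule integrable_bounded_pmf)
    show "integrable (measure_pmf (play alg nx ny T)) (regret F)"
    proof (rule integrable_bounded_pmf[where B = "K + 2 * real T"])
      fix h assume h: "h \<in> set_pmf (play alg nx ny T)"
      show "\<bar>regret F h\<bar> \<le> K + 2 * real T"
        using b[OF h] reg_le[OF h] reg_ge[OF h] by linarith
    qed
    show "AE h in measure_pmf (play alg nx ny T). regret F h \<le> \<Phi> h"
      using reg_le by (simp add: AE_measure_pmf_iff)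
  qed
  also have "\<dots> \<le> R [] []" by (rule main) simp
  finally show "measure_pmf.expectation (play alg nx ny T) (regret F) \<le> R [] []" .
qed

subsection \<open>The relaxation\<close>

text \<open>This is \<open>A\<^sub>s\<close>: \<open>xs\<close> already ends with the current
  instance while \<open>ys\<close> stops one round earlier, so the current outcome does not
  enter.\<close>

definition label_mass :: "real \<Rightarrow> nat \<Rightarrow> ('x \<Rightarrow> real) set \<Rightarrow> 'x list \<Rightarrow> real list \<Rightarrow> real \<Rightarrow> real" where
  "label_mass lam T F xs ys s =
     (\<Sum>\<sigma>\<in>{\<sigma>. \<sigma> @ [s] \<in> restr F xs}. weight F T xs (\<sigma> @ [s]) * exp (- lam * cumloss \<sigma> ys))"

lemma version_space_snoc:
  "length \<sigma> = length xs \<Longrightarrow>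
    version_space F (xs @ [x]) (\<sigma> @ [s]) = {f \<in> version_space F xs \<sigma>. f x = s}"
  by (auto simp: version_space_def)

lemma in_restr_iff: "\<sigma> \<in> restr F xs \<longleftrightarrow> version_space F xs \<sigma> \<noteq> {}"
  by (auto simp: restr_def version_space_def)

lemma length_restr: "\<sigma> \<in> restr F xs \<Longrightarrow> length \<sigma> = length xs"
  by (auto simp: restr_def)

lemma restr_snocD: "\<sigma> @ [s] \<in> restr F (xs @ [x]) \<Longrightarrow> \<sigma> \<in> restr F xs"
  by (auto simp: restr_def)

lemma cumloss_snoc:
  "length \<sigma> = length ys \<Longrightarrow> cumloss (\<sigma> @ [s]) (ys @ [y]) = cumloss \<sigma> ys + \<bar>s - y\<bar>"
  by (simp add: cumloss_def nth_append)

lemma weight_ge_1: "1 \<le> weight F T xs \<sigma>"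
  using binom_sum_ge_1 by (simp add: weight_def)

locale littlestone_class =
  fixes F :: "('x \<Rightarrow> real) set" and lam :: real
  assumes nonempty: "F \<noteq> {}"
    and range_labels: "\<forall>f\<in>F. \<forall>x. f x \<in> labels"
    and finite_Ldim: "Ldim F < \<infinity>"
    and lam_pos: "0 < lam"
begin

section \<open>Sums over realised sign patterns\<close>

lemma finite_restr: "finite (restr F xs)"
proof (rule finite_subset)
  show "restr F xs \<subseteq> {\<sigma>. set \<sigma> \<subseteq> labels \<and> length \<sigma> = length xs}"
    using range_labels by (auto simp: restr_def)
  show "finite {\<sigma>. set \<sigma> \<subseteq> labels \<and> length \<sigma> = length xs}"
    by (rule finite_lists_length_eq) (simp add: labels_def)
qed

lemma finite_restr_snoc: "finite {\<sigma>. \<sigma> @ [s] \<in> restr F xs}"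
  using finite_vimageI[OF finite_restr[of xs], of "\<lambda>\<sigma>. \<sigma> @ [s]"] by (simp add: vimage_def inj_on_def)

lemma last_restr: "\<sigma> @ [s] \<in> restr F xs \<Longrightarrow> s = 1 \<or> s = -1"
  using range_labels by (cases xs rule: rev_cases) (auto simp: restr_def labels_def)

text \<open>Only \<open>1\<close> and \<open>-1\<close> occur as last labels, so the pairs form two
  disjoint fibres. This reduces the sums in \<open>prob_plus\<close> and \<open>mean_pred\<close> to
  the two label masses.\<close>

lemma sum_restr_pairs:
  fixes h :: "real list \<Rightarrow> real \<Rightarrow> real"
  shows "(\<Sum>(\<sigma>, s)\<in>{(\<sigma>, s). \<sigma> @ [s] \<in> restr F xs}. h \<sigma> s)
    = (\<Sum>\<sigma>\<in>{\<sigma>. \<sigma> @ [1] \<in> restr F xs}. h \<sigma> 1) + (\<Sum>\<sigma>\<in>{\<sigma>. \<sigma> @ [-1] \<in> restr F xs}. h \<sigma> (-1))"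
proof -
  have "{(\<sigma>, s). \<sigma> @ [s] \<in> restr F xs}
      = (\<lambda>\<sigma>. (\<sigma>, 1)) ` {\<sigma>. \<sigma> @ [1] \<in> restr F xs} \<union> (\<lambda>\<sigma>. (\<sigma>, -1)) ` {\<sigma>. \<sigma> @ [-1] \<in> restr F xs}"
    by (auto dest: last_restr)
  then show ?thesis
    using finite_restr_snoc
    by (simp add: sum.union_disjoint sum.reindex inj_on_def disjoint_iff image_iff)
qed

lemma sum_restr_snoc:
  fixes h :: "real list \<Rightarrow> real"
  shows "(\<Sum>\<tau>\<in>restr F (xs @ [x]). h \<tau>)
    = (\<Sum>\<sigma>\<in>{\<sigma>. \<sigma> @ [1] \<in> restr F (xs @ [x])}. h (\<sigma> @ [1]))
      + (\<Sum>\<sigma>\<in>{\<sigma>. \<sigma> @ [-1] \<in> restr F (xs @ [x])}. h (\<sigma> @ [-1]))"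
proof -
  have "(\<Sum>\<tau>\<in>restr F (xs @ [x]). h \<tau>)
      = (\<Sum>(\<sigma>, s)\<in>{(\<sigma>, s). \<sigma> @ [s] \<in> restr F (xs @ [x])}. h (\<sigma> @ [s]))"
    by (rule sum.reindex_bij_witness[where i = "\<lambda>(\<sigma>, s). \<sigma> @ [s]" and j = "\<lambda>\<tau>. (butlast \<tau>, last \<tau>)"])
      (auto simp: restr_def butlast_append)
  then show ?thesis by (simp add: sum_restr_pairs)
qed

section \<open>The two label masses against the mass one round earlier\<close>

lemma label_mass_nonneg: "0 \<le> label_mass lam T F xs ys s"
  unfolding label_mass_def
  by (intro sum_nonneg mult_nonneg_nonneg) (auto simp: weight_def)

lemma label_mass_pos: "0 < label_mass lam T F (xs @ [x]) ys 1 + label_mass lam T F (xs @ [x]) ys (-1)"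
proof -
  \<comment> \<open>Removing the current label by \<open>butlast\<close> makes this sum the total of
    the two masses; it has a term because \<open>F\<close> is nonempty.\<close>
  have "0 < (\<Sum>\<tau>\<in>restr F (xs @ [x]). weight F T (xs @ [x]) \<tau> * exp (- lam * cumloss (butlast \<tau>) ys))"
    using nonempty
    by (intro sum_pos finite_restr mult_pos_pos less_le_trans[OF zero_less_one weight_ge_1]) (auto simp: restr_def)
  then show ?thesis unfolding sum_restr_snoc label_mass_def by simp
qed

text \<open>If both extensions are realised, the drop in dimension and Pascal's rule give the bound;
  otherwise monotonicity of the binomial sums does. The function \<open>w\<close> must assign
  \<open>0\<close> to unrealised extensions explicitly, because \<open>weight\<close> is at least
  \<open>1\<close> even on an empty version space.\<close>

lemma weight_snoc_add_le:
  fixes x :: 'x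
  assumes "length xs < T" and len: "length \<sigma> = length xs"
  defines "w \<equiv> \<lambda>s. if \<sigma> @ [s] \<in> restr F (xs @ [x]) then weight F T (xs @ [x]) (\<sigma> @ [s]) else 0"
  shows "w 1 + w (-1) \<le> weight F T xs \<sigma>"
proof -
  define V where "V = version_space F xs \<sigma>"
  define D where "D s = the_enat (Ldim {f \<in> V. f x = s})" for s
  obtain n where n: "T - length xs = Suc n" "T - Suc (length xs) = n"
    using assms(1) by (metis Suc_diff_Suc)
  have finV: "Ldim V < \<infinity>"
    by (rule le_less_trans[OF Ldim_mono finite_Ldim]) (auto simp: V_def version_space_def)
  have D: "D s \<le> the_enat (Ldim V)" for s
    unfolding D_def by (rule the_enat_Ldim_mono[OF _ finV]) auto
  have w: "w s = (if {f \<in> V. f x = s} \<noteq> {} then real (binom_sum (D s) n) else 0)" for s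
    by (simp add: w_def weight_def in_restr_iff version_space_snoc[OF len] V_def[symmetric] D_def n) auto
  have W: "weight F T xs \<sigma> = real (binom_sum (the_enat (Ldim V)) (Suc n))"
    by (simp add: weight_def V_def n)
  have one: "binom_sum (D s) n \<le> binom_sum (the_enat (Ldim V)) (Suc n)" for s
    by (rule order_trans[OF binom_sum_mono[OF D] binom_sum_le_Suc])
  show ?thesis
  proof (cases "{f \<in> V. f x = 1} \<noteq> {} \<and> {f \<in> V. f x = -1} \<noteq> {}")
    case True
    then have "Suc (min (D 1) (D (-1))) \<le> the_enat (Ldim V)"
      unfolding D_def by (intro Ldim_split finV) auto
    from binom_sum_add_le[OF D D this, of n]
    show ?thesis using True unfolding w W by (simp del: of_nat_add flip: of_nat_add)
  next
    case False
    then show ?thesis using one unfolding w W by auto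
  qed
qed

text \<open>With weight \<open>0\<close> for unrealised extensions, both masses become sums over
  \<open>restr F xs\<close> with the same loss factor, and the bound holds pattern by
  pattern.\<close>

lemma label_mass_add_le:
  assumes "length xs < T"
  shows "label_mass lam T F (xs @ [x]) ys 1 + label_mass lam T F (xs @ [x]) ys (-1)
    \<le> (\<Sum>\<sigma>\<in>restr F xs. weight F T xs \<sigma> * exp (- lam * cumloss \<sigma> ys))"
proof -
  define w where "w \<sigma> s = (if \<sigma> @ [s] \<in> restr F (xs @ [x]) then weight F T (xs @ [x]) (\<sigma> @ [s]) else 0)"
    for \<sigma> s
  have mass: "label_mass lam T F (xs @ [x]) ys s
      = (\<Sum>\<sigma>\<in>restr F xs. w \<sigma> s * exp (- lam * cumloss \<sigma> ys))" for s
    unfolding label_mass_def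
    by (rule sum.mono_neutral_cong_left) (auto simp: w_def finite_restr dest: restr_snocD)
  have "label_mass lam T F (xs @ [x]) ys 1 + label_mass lam T F (xs @ [x]) ys (-1)
      = (\<Sum>\<sigma>\<in>restr F xs. (w \<sigma> 1 + w \<sigma> (-1)) * exp (- lam * cumloss \<sigma> ys))"
    by (simp add: mass sum.distrib algebra_simps)
  also have "\<dots> \<le> (\<Sum>\<sigma>\<in>restr F xs. weight F T xs \<sigma> * exp (- lam * cumloss \<sigma> ys))"
    unfolding w_def
    by (intro sum_mono mult_right_mono weight_snoc_add_le assms) (auto dest: length_restr)
  finally show ?thesis .
qed

section \<open>The relaxation and the predictions in terms of label masses\<close>

lemma Rel_snoc:
  assumes "length ys = length xs"
  shows "Rel lam T F (xs @ [x]) (ys @ [y]) =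
    1 / lam * ln (label_mass lam T F (xs @ [x]) ys 1 * exp (- lam * \<bar>1 - y\<bar>)
      + label_mass lam T F (xs @ [x]) ys (-1) * exp (- lam * \<bar>-1 - y\<bar>))
    + 2 * lam * real (T - Suc (length xs))"
proof -
  \<comment> \<open>The loss of the current round depends only on the last label and factors out of
    the sum.\<close>
  have "(\<Sum>\<sigma>\<in>{\<sigma>. \<sigma> @ [s] \<in> restr F (xs @ [x])}.
          weight F T (xs @ [x]) (\<sigma> @ [s]) * exp (- lam * cumloss (\<sigma> @ [s]) (ys @ [y])))
      = label_mass lam T F (xs @ [x]) ys s * exp (- lam * \<bar>s - y\<bar>)" for s
    unfolding label_mass_def sum_distrib_right
    by (intro sum.cong refl)
      (auto dest!: restr_snocD length_restr simp: assms cumloss_snoc algebra_simps simp flip: exp_add)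
  then show ?thesis unfolding Rel_def sum_restr_snoc by simp
qed

lemma prob_plus_eq:
  "prob_plus lam T F xs ys
    = label_mass lam T F xs ys 1 / (label_mass lam T F xs ys 1 + label_mass lam T F xs ys (-1))"
  by (simp add: prob_plus_def label_mass_def sum_restr_pairs)

text \<open>The factor \<open>exp (- lam * (1 - s))\<close> is \<open>1\<close> at
  \<open>s = 1\<close> and \<open>exp (- (2 * lam))\<close> at \<open>s = -1\<close>; with
  \<open>1 + s\<close> the roles are exchanged.\<close>

lemma mean_pred_eq:
  "mean_pred lam T F xs ys = 1 / (2 * lam) *
    ln ((label_mass lam T F xs ys 1 + label_mass lam T F xs ys (-1) * exp (- (2 * lam)))
      / (label_mass lam T F xs ys 1 * exp (- (2 * lam)) + label_mass lam T F xs ys (-1)))"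
  by (simp add: mean_pred_def label_mass_def sum_restr_pairs sum_distrib_right mult.commute[of lam 2])

lemma prob_plus_bounds:
  "0 \<le> prob_plus lam T F (xs @ [x]) ys" "prob_plus lam T F (xs @ [x]) ys \<le> 1"
  using label_mass_nonneg[of T "xs @ [x]" ys] label_mass_pos[of T xs x ys]
  by (auto simp: prob_plus_eq)

text \<open>Both expressions dominate the positive total mass with the discount applied to both
  labels. They are the arguments of the logarithms below.\<close>

lemma discounted_mass_pos:
  "0 < label_mass lam T F (xs @ [x]) ys 1 + label_mass lam T F (xs @ [x]) ys (-1) * exp (- (2 * lam))"
  "0 < label_mass lam T F (xs @ [x]) ys 1 * exp (- (2 * lam)) + label_mass lam T F (xs @ [x]) ys (-1)"
proof -
  let ?a = "label_mass lam T F (xs @ [x]) ys 1" and ?b = "label_mass lam T F (xs @ [x]) ys (-1)"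
  have "0 < (?a + ?b) * exp (- (2 * lam))"
    by (intro mult_pos_pos label_mass_pos) simp
  also have "(?a + ?b) * exp (- (2 * lam)) \<le> ?a + ?b * exp (- (2 * lam))"
    using mult_left_mono[of "exp (- (2 * lam))" 1 ?a] label_mass_nonneg lam_pos
    by (simp add: algebra_simps)
  finally show "0 < ?a + ?b * exp (- (2 * lam))" .
  have "0 < (?a + ?b) * exp (- (2 * lam))"
    by (intro mult_pos_pos label_mass_pos) simp
  also have "(?a + ?b) * exp (- (2 * lam)) \<le> ?a * exp (- (2 * lam)) + ?b"
    using mult_left_mono[of "exp (- (2 * lam))" 1 ?b] label_mass_nonneg lam_pos
    by (simp add: algebra_simps)
  finally show "0 < ?a * exp (- (2 * lam)) + ?b" .
qed

text \<open>The two discounted masses differ by a factor of at most \<open>exp (2 * lam)\<close> in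
  either direction. Hence the prescribed mean is attainable, and the truncation in
  \<open>bernoulli_pmf\<close> never takes effect.\<close>

lemma abs_mean_pred_le: "\<bar>mean_pred lam T F (xs @ [x]) ys\<bar> \<le> 1"
proof -
  let ?a = "label_mass lam T F (xs @ [x]) ys 1" and ?b = "label_mass lam T F (xs @ [x]) ys (-1)"
  let ?e = "exp (- (2 * lam))" and ?E = "exp (2 * lam)"
  note pos = discounted_mass_pos[of T xs x ys]
  have ineq: "c * 1 + d * ?e \<le> (c * ?e + d) * ?E" if "0 \<le> d" for c d
  proof -
    have "?e \<le> 1" "1 \<le> ?E" using lam_pos by auto
    then have "?e \<le> ?E" by linarith
    then have "d * ?e \<le> d * ?E" using that by (rule mult_left_mono)
    then show ?thesis by (simp add: algebra_simps flip: exp_add)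
  qed
  have "ln (?a + ?b * ?e) \<le> ln ((?a * ?e + ?b) * ?E)"
    using ineq[OF label_mass_nonneg, where c = ?a] pos by simp
  then have 1: "ln (?a + ?b * ?e) \<le> ln (?a * ?e + ?b) + 2 * lam"
    using pos by (simp add: ln_mult)
  have "ln (?a * ?e + ?b) \<le> ln ((?a + ?b * ?e) * ?E)"
    using ineq[OF label_mass_nonneg, where c = ?b] pos by (simp add: add.commute)
  then have 2: "ln (?a * ?e + ?b) \<le> ln (?a + ?b * ?e) + 2 * lam"
    using pos by (simp add: ln_mult)
  show ?thesis
    using 1 2 lam_pos pos by (simp add: mean_pred_eq ln_div abs_le_iff field_simps)
qed

section \<open>Admissibility of the two algorithms\<close>

lemma weighted_alg_step:
  assumes "length xs < T" "length ys = length xs" "y \<in> labels"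
  shows "expected_loss (weighted_alg lam T F (xs @ [x]) ys) y + Rel lam T F (xs @ [x]) (ys @ [y])
    \<le> Rel lam T F xs ys"
proof -
  let ?a = "label_mass lam T F (xs @ [x]) ys 1" and ?b = "label_mass lam T F (xs @ [x]) ys (-1)"
  let ?B = "\<Sum>\<sigma>\<in>restr F xs. weight F T xs \<sigma> * exp (- lam * cumloss \<sigma> ys)"
  note pos = label_mass_pos[of T xs x ys]
  note le = label_mass_add_le[OF assms(1), of x ys]
  \<comment> \<open>One fewer remaining round releases the \<open>2 * lam\<close> that
    \<open>exp_weights_step\<close> consumes.\<close>
  have T: "2 * lam * real (T - length xs) = 2 * lam + 2 * lam * real (T - Suc (length xs))"
    using assms(1) by (simp add: of_nat_diff algebra_simps)
  have q: "1 - prob_plus lam T F (xs @ [x]) ys = ?b / (?a + ?b)"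
    using pos by (simp add: prob_plus_eq field_simps)
  \<comment> \<open>Outcome \<open>1\<close> discounts the mass \<open>?b\<close> of the other
    label; \<open>minus\<close> is the same estimate with the masses exchanged.\<close>
  have plus: "2 * (?b / (?a + ?b)) + 1 / lam * ln (?a + ?b * exp (- (2 * lam))) \<le> 1 / lam * ln ?B + 2 * lam"
    using pos le lam_pos by (intro exp_weights_step label_mass_nonneg)
  have minus: "2 * (?a / (?a + ?b)) + 1 / lam * ln (?a * exp (- (2 * lam)) + ?b) \<le> 1 / lam * ln ?B + 2 * lam"
    unfolding add.commute[of ?a ?b] add.commute[of "?a * exp (- (2 * lam))" ?b]
    using pos le lam_pos by (intro exp_weights_step label_mass_nonneg) linarith+
  consider "y = 1" | "y = -1" using assms(3) by (auto simp: labels_def)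
  then show ?thesis
  proof cases
    case 1
    have "expected_loss (weighted_alg lam T F (xs @ [x]) ys) 1 = 2 * (?b / (?a + ?b))"
      unfolding weighted_alg_def expected_loss_label_pmf[OF prob_plus_bounds] q ..
    then show ?thesis
      using plus by (simp add: 1 Rel_snoc[OF assms(2)] Rel_def[of lam T F xs] T mult.commute[of lam 2])
  next
    case 2
    have "expected_loss (weighted_alg lam T F (xs @ [x]) ys) (-1) = 2 * (?a / (?a + ?b))"
      unfolding weighted_alg_def expected_loss_label_pmf[OF prob_plus_bounds] unfolding prob_plus_eq ..
    then show ?thesis
      using minus
      by (simp add: 2 Rel_snoc[OF assms(2)] Rel_def[of lam T F xs] T mult.commute[of lam 2])
  qed
qed

lemma mean_alg_step:
  assumes "length xs < T" "length ys = length xs" "y \<in> labels"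
  shows "expected_loss (mean_alg lam T F (xs @ [x]) ys) y + Rel lam T F (xs @ [x]) (ys @ [y])
    \<le> Rel lam T F xs ys"
proof -
  let ?m = "mean_pred lam T F (xs @ [x]) ys"
  let ?R = "\<lambda>y. Rel lam T F (xs @ [x]) (ys @ [y])"
  note pos = discounted_mass_pos[of T xs x ys]
  define P where "P = ln (label_mass lam T F (xs @ [x]) ys 1
    + label_mass lam T F (xs @ [x]) ys (-1) * exp (- (2 * lam)))"
  define Q where "Q = ln (label_mass lam T F (xs @ [x]) ys 1 * exp (- (2 * lam))
    + label_mass lam T F (xs @ [x]) ys (-1))"
  have R: "?R 1 = 1 / lam * P + 2 * lam * real (T - Suc (length xs))"
    "?R (-1) = 1 / lam * Q + 2 * lam * real (T - Suc (length xs))"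
    by (simp_all add: Rel_snoc[OF assms(2)] P_def Q_def mult.commute[of lam 2])
  have "?m = 1 / (2 * lam) * (P - Q)"
    unfolding mean_pred_eq P_def Q_def using pos by (subst ln_div) auto
  \<comment> \<open>The losses at \<open>1\<close> and \<open>-1\<close> are \<open>1 - ?m\<close>
    and \<open>1 + ?m\<close>, so this identity says that loss plus relaxation is the same for both
    labels.\<close>
  then have m: "2 * ?m = ?R 1 - ?R (-1)"
    unfolding R by (simp add: right_diff_distrib)
  have p: "0 \<le> (1 + ?m) / 2" "(1 + ?m) / 2 \<le> 1"
    using abs_mean_pred_le[of T xs x ys] by (auto simp: abs_le_iff)
  have loss: "expected_loss (mean_alg lam T F (xs @ [x]) ys) 1 = 1 - ?m"
      "expected_loss (mean_alg lam T F (xs @ [x]) ys) (-1) = 1 + ?m"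
    unfolding mean_alg_def expected_loss_label_pmf[OF p] by (simp_all add: field_simps)
  \<comment> \<open>Adding these two inequalities eliminates the prediction of
    \<open>weighted_alg\<close>, and half of the sum bounds the common value.\<close>
  have "expected_loss (weighted_alg lam T F (xs @ [x]) ys) 1 + ?R 1 \<le> Rel lam T F xs ys"
    "expected_loss (weighted_alg lam T F (xs @ [x]) ys) (-1) + ?R (-1) \<le> Rel lam T F xs ys"
    using assms by (auto intro!: weighted_alg_step simp: labels_def)
  then have "2 + ?R 1 + ?R (-1) \<le> 2 * Rel lam T F xs ys"
    by (simp add: weighted_alg_def expected_loss_label_pmf[OF prob_plus_bounds] algebra_simps)
  then show ?thesis
    using assms(3) m loss by (auto simp: labels_def)
qed

lemma weighted_alg_dist: "weighted_alg lam T F (xs @ [x]) ys \<in> label_dists"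
  unfolding weighted_alg_def by (rule label_pmf_label_dists[OF prob_plus_bounds])

lemma mean_alg_dist: "mean_alg lam T F (xs @ [x]) ys \<in> label_dists"
  using abs_mean_pred_le[of T xs x ys] unfolding mean_alg_def
  by (intro label_pmf_label_dists) (auto simp: abs_le_iff)

lemma admissible_weighted_alg: "admissible_algorithm T (Rel lam T F) (weighted_alg lam T F)"
  by (intro admissible_algorithmI weighted_alg_dist weighted_alg_step)

lemma admissible_mean_alg: "admissible_algorithm T (Rel lam T F) (mean_alg lam T F)"
  by (intro admissible_algorithmI mean_alg_dist mean_alg_step)

section \<open>Comparison with the best function and the regret bound\<close>

lemma Rel_ge:
  assumes "f \<in> F"
  shows "- cumloss (map f xs) ys \<le> Rel lam T F xs ys"
proof -
  \<comment> \<open>Only the pattern of \<open>f\<close> is kept: its weight is at least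
    \<open>1\<close> and all other terms are nonnegative.\<close>
  have "exp (- lam * cumloss (map f xs) ys) \<le> weight F T xs (map f xs) * exp (- lam * cumloss (map f xs) ys)"
    using mult_right_mono[OF weight_ge_1[of F T xs "map f xs"], of "exp (- lam * cumloss (map f xs) ys)"] by simp
  also have "\<dots> \<le> (\<Sum>\<sigma>\<in>restr F xs. weight F T xs \<sigma> * exp (- lam * cumloss \<sigma> ys))"
    using assms finite_restr
    by (intro member_le_sum[where f = "\<lambda>\<sigma>. weight F T xs \<sigma> * exp (- lam * cumloss \<sigma> ys)"])
      (auto simp: restr_def weight_def)
  finally have "- lam * cumloss (map f xs) ys
      \<le> ln (\<Sum>\<sigma>\<in>restr F xs. weight F T xs \<sigma> * exp (- lam * cumloss \<sigma> ys))"
    by (intro ln_ge_iff[THEN iffD2]) (auto intro: less_le_trans[OF exp_gt_zero])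
  then have "1 / lam * (- lam * cumloss (map f xs) ys)
      \<le> 1 / lam * ln (\<Sum>\<sigma>\<in>restr F xs. weight F T xs \<sigma> * exp (- lam * cumloss \<sigma> ys))"
    using lam_pos by (intro mult_left_mono) auto
  moreover have "1 / lam * (- lam * cumloss (map f xs) ys) = - cumloss (map f xs) ys"
    using lam_pos by simp
  moreover have "0 \<le> 2 * lam * real (T - length xs)" using lam_pos by simp
  ultimately show ?thesis unfolding Rel_def by linarith
qed

text \<open>The loss enters as a parameter \<open>l\<close> because
  \<open>admissible_relaxation\<close> writes it as an indexed sum and \<open>regret\<close> as a
  sum over the transcript.\<close>

lemma neg_INF_le_Rel:
  assumes "\<And>f. f \<in> F \<Longrightarrow> cumloss (map f xs) ys = l f"
  shows "- (INF f\<in>F. l f) \<le> Rel lam T F xs ys"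
proof -
  have "- Rel lam T F xs ys \<le> (INF f\<in>F. l f)"
  proof (rule cINF_greatest[OF nonempty])
    fix f assume "f \<in> F"
    then show "- Rel lam T F xs ys \<le> l f" using Rel_ge[of f xs ys T] assms by simp
  qed
  then show ?thesis by simp
qed

text \<open>Any single function loses at most \<open>2\<close> per round. This supplies the
  assumption \<open>low\<close> of the regret argument.\<close>

lemma Rel_bounded_below:
  assumes "length xs \<le> T" "length ys = length xs" "set ys \<subseteq> labels"
  shows "- (2 * real T) \<le> Rel lam T F xs ys"
proof -
  obtain f where f: "f \<in> F" using nonempty by blast
  have "cumloss (map f xs) ys \<le> (\<Sum>i<length xs. 2)"
    unfolding cumloss_def length_map using assms f range_labels
    by (intro sum_mono) (auto intro!: abs_diff_labels_le)
  also have "\<dots> \<le> 2 * real T" using assms(1) by simp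
  finally show ?thesis using Rel_ge[OF f, of xs ys T] by linarith
qed

lemma regret_bounded_by_Rel:
  assumes "admissible_algorithm T (Rel lam T F) alg"
  shows "regret_bounded_by T F alg (Rel lam T F [] [])"
proof (rule regret_bounded_by_admissible[OF assms nonempty range_labels Rel_bounded_below])
  fix h :: "'x transcript"
  have "cumloss (map f (instances h)) (outcomes h) = (\<Sum>(x, yhat, y)\<leftarrow>h. \<bar>f x - y\<bar>)" for f :: "'x \<Rightarrow> real"
    by (simp add: cumloss_def sum_list_sum_nth atLeast0LessThan case_prod_beta)
  then show "- (INF f\<in>F. \<Sum>(x, yhat, y)\<leftarrow>h. \<bar>f x - y\<bar>) \<le> Rel lam T F (instances h) (outcomes h)"
    by (rule neg_INF_le_Rel)
qed

lemma admissible_Rel: "admissible_relaxation T F (Rel lam T F)"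
  unfolding admissible_relaxation_def
proof (intro allI impI conjI ballI)
  fix xs :: "'x list" and ys t
  assume len: "length xs = T \<and> length ys = T \<and> set ys \<subseteq> labels"
  show "- (INF f\<in>F. \<Sum>i<T. \<bar>f (xs ! i) - ys ! i\<bar>) \<le> Rel lam T F xs ys"
    using len by (intro neg_INF_le_Rel) (simp add: cumloss_def)
  assume "t \<in> {1..T}"
  let ?xs = "take (t - 1) xs" and ?ys = "take (t - 1) ys"
  have t: "length ?xs < T" "length ?ys = length ?xs" "set ?ys \<subseteq> labels"
    using len \<open>t \<in> {1..T}\<close> by (auto dest: in_set_takeD)
  \<comment> \<open>The prediction of \<open>weighted_alg\<close> is the witness that bounds the
    infimum for every \<open>x\<close>.\<close>
  show "(SUP x. INF q\<in>label_dists. ereal (MAX y\<in>labels. expected_loss q y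
      + Rel lam T F (?xs @ [x]) (?ys @ [y]))) \<le> ereal (Rel lam T F ?xs ?ys)"
  proof (rule SUP_least, rule INF_lower2[OF weighted_alg_dist])
    fix x
    show "ereal (MAX y\<in>labels. expected_loss (weighted_alg lam T F (?xs @ [x]) ?ys) y
        + Rel lam T F (?xs @ [x]) (?ys @ [y])) \<le> ereal (Rel lam T F ?xs ?ys)"
      using weighted_alg_step[OF t(1,2), of _ x] by (simp add: labels_def)
  qed
qed

lemma predicts_weighted_alg:
  "predicts_plus_with_prob T (weighted_alg lam T F) (prob_plus lam T F)"
  unfolding predicts_plus_with_prob_def
proof (intro ballI allI impI)
  fix t and xs :: "'x list" and ys :: "real list"
  assume "t \<in> {1..T}" "length xs = t \<and> length ys = t - 1 \<and> set ys \<subseteq> labels"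
  \<comment> \<open>Since \<open>t\<close> is at least \<open>1\<close>, the sequence has a last
    instance, which is the form required by \<open>prob_plus_bounds\<close>.\<close>
  then obtain zs x where xs: "xs = zs @ [x]" by (cases xs rule: rev_cases) auto
  show "weighted_alg lam T F xs ys \<in> label_dists \<and>
      pmf (weighted_alg lam T F xs ys) 1 = prob_plus lam T F xs ys \<and>
      pmf (weighted_alg lam T F xs ys) (-1) = 1 - prob_plus lam T F xs ys"
    using prob_plus_bounds[of T zs x ys] weighted_alg_dist[of T zs x ys]
    by (simp add: xs weighted_alg_def pmf_label_pmf_1 pmf_label_pmf_minus_1)
qed

lemma predicts_mean_alg: "predicts_with_mean T (mean_alg lam T F) (mean_pred lam T F)"
  unfolding predicts_with_mean_def
proof (intro ballI allI impI)
  fix t and xs :: "'x list" and ys :: "real list"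
  assume "t \<in> {1..T}" "length xs = t \<and> length ys = t - 1 \<and> set ys \<subseteq> labels"
  then obtain zs x where xs: "xs = zs @ [x]" by (cases xs rule: rev_cases) auto
  show "mean_alg lam T F xs ys \<in> label_dists \<and>
      measure_pmf.expectation (mean_alg lam T F xs ys) (\<lambda>yhat. yhat) = mean_pred lam T F xs ys"
    using abs_mean_pred_le[of T zs x ys] mean_alg_dist[of T zs x ys]
    by (simp add: xs mean_alg_def expectation_label_pmf abs_le_iff field_simps)
qed

end

theorem proposition10:
  fixes F :: "('x \<Rightarrow> real) set" and lam :: real and T :: nat
  assumes "F \<noteq> {}"
    and "\<forall>f\<in>F. \<forall>x. f x \<in> labels"
    and "Ldim F < \<infinity>"
    and "lam > 0"
  shows "admissible_relaxation T F (Rel lam T F)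
    \<and> predicts_plus_with_prob T (weighted_alg lam T F) (prob_plus lam T F)
    \<and> admissible_algorithm T (Rel lam T F) (weighted_alg lam T F)
    \<and> regret_bounded_by T F (weighted_alg lam T F) (Rel lam T F [] [])
    \<and> predicts_with_mean T (mean_alg lam T F) (mean_pred lam T F)
    \<and> admissible_algorithm T (Rel lam T F) (mean_alg lam T F)
    \<and> regret_bounded_by T F (mean_alg lam T F) (Rel lam T F [] [])"
proof -
  interpret littlestone_class F lam
    using assms by unfold_locales
  show ?thesis
    by (intro conjI admissible_Rel predicts_weighted_alg admissible_weighted_alg predicts_mean_alg
        admissible_mean_alg regret_bounded_by_Rel)
qed

end
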